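(* The exponential generating function $C_1(z)=\sum_{n\ge0}c_{1,n}\frac{z^n}{n!}$ of compacted trees of right height at most $1$ is D-finite and satisfies $$(1-2z)C_1''(z)-(3-z)C_1'(z)=0,\qquad C_1(0)=1,\ C_1'(0)=1.$$ Moreover $C_1'(z)=\frac{e^{z/2}}{(1-2z)^{5/4}}$ and $$c_{1,n}=\frac{e^{1/4}}{\Gamma(1/4)}\frac{n!\,2^{n+1}}{n^{3/4}}\left(1+\mathcal O\!\left(\frac1n\right)\right)\quad(n\to\infty).$$
   Context: A full binary tree is a rooted plane tree whose nodes have $0$ or $2$ ordered children; a fringe subtree is a node with all its descendants. The compacted tree of a full binary tree $T$ is the DAG obtained by post-order traversal (left, right, node), replacing each edge leading to a fringe subtree identical to one seen earlier by a pointer to the first occurrence and deleting the duplicate. Its size is the number of its internal nodes; distinct $T$ give distinct compacted trees. The spine is the compacted tree with pointers and the leaf removed; the right height is the maximal number of right spine edges on a path from the root to a spine node. $c_{1,n}$ counts compacted trees of size $n$ with right height at most $1$. *)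

theory Defs
  imports "HOL-Analysis.Analysis" "HOL-Library.Landau_Symbols" "HOL-Library.Tree"
begin

datatype full_tree = FLeaf | FNode full_tree full_tree

text \<open>
  A DAG is encoded along its non-pointer edges, which form a plane tree. Its nodes are the
  occurrences of \<open>CLeaf\<close> and \<open>CNode\<close>, and they are numbered from 0 in post-order;
  \<open>Pointer k\<close> stands for an edge pointing to the node with number \<open>k\<close>.
\<close>

datatype ctree = CLeaf | CNode ctree ctree | Pointer nat

text \<open>
  Post-order traversal (left, right, node). The list \<open>seen\<close> holds the distinct fringe subtrees
  met so far, in order of their first occurrence, so that the position of a subtree in
  \<open>seen\<close> is the post-order number of the corresponding node of the DAG.
\<close>

primrec compact_aux :: "full_tree \<Rightarrow> full_tree list \<Rightarrow> ctree \<times> full_tree list" where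
  "compact_aux FLeaf seen =
     (if FLeaf \<in> set seen then (Pointer (length (takeWhile (\<lambda>s. s \<noteq> FLeaf) seen)), seen)
      else (CLeaf, seen @ [FLeaf]))"
| "compact_aux (FNode l r) seen =
     (if FNode l r \<in> set seen
      then (Pointer (length (takeWhile (\<lambda>s. s \<noteq> FNode l r) seen)), seen)
      else (let (l', seen\<^sub>1) = compact_aux l seen;
                (r', seen\<^sub>2) = compact_aux r seen\<^sub>1
            in (CNode l' r', seen\<^sub>2 @ [FNode l r])))"

definition compacted :: "full_tree \<Rightarrow> ctree" where
  "compacted T = fst (compact_aux T [])"

primrec internal_nodes :: "ctree \<Rightarrow> nat" where
  "internal_nodes CLeaf = 0"
| "internal_nodes (Pointer k) = 0"
| "internal_nodes (CNode l r) = Suc (internal_nodes l + internal_nodes r)"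

text \<open>
  In the spine a node may lack a left or a right child; here \<open>Leaf\<close> is the empty tree.
\<close>

primrec spine :: "ctree \<Rightarrow> unit tree" where
  "spine CLeaf = Leaf"
| "spine (Pointer k) = Leaf"
| "spine (CNode l r) = Node (spine l) () (spine r)"

text \<open>
  A node is addressed by the path leading to it from the root, \<open>True\<close> being a right edge.
\<close>

primrec node_paths :: "'a tree \<Rightarrow> bool list set" where
  "node_paths Leaf = {}"
| "node_paths (Node l x r) =
     insert [] (Cons False ` node_paths l \<union> Cons True ` node_paths r)"

text \<open>The inserted 0 only matters for the empty tree, whose right height is 0 by convention.\<close>

definition right_height :: "'a tree \<Rightarrow> nat" where
  "right_height t = Max (insert 0 ((\<lambda>p. count_list p True) ` node_paths t))"

definition compacted_count :: "nat \<Rightarrow> nat \<Rightarrow> nat" where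
  "compacted_count k n =
     card {C \<in> range compacted. internal_nodes C = n \<and> right_height (spine C) \<le> k}"

definition compacted_egf :: "nat \<Rightarrow> complex fps" where
  "compacted_egf k = Abs_fps (\<lambda>n. of_nat (compacted_count k n) / fact n)"

definition D_finite :: "'a :: field_char_0 fps \<Rightarrow> bool" where
  "D_finite F \<longleftrightarrow>
     (\<exists>r (p :: nat \<Rightarrow> 'a poly). p r \<noteq> 0 \<and>
        (\<Sum>i\<le>r. fps_of_poly (p i) * (fps_deriv ^^ i) F) = 0)"

end

theory Submission
  imports Defs
begin

text \<open>
  Compaction is injective, so one may count full binary trees instead of compacted trees. If \<open>k\<close>
  subtrees have been seen, a pointer has \<open>k\<close> possible targets, and the only constraint on a new
  node is that its two children are not those of one of the \<open>k - 1\<close> internal nodes seen before;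
  this can only be violated if both children are pointers. The resulting recursion on (right height,
  number of seen subtrees, number of new nodes) collapses for right height 1 to
  \<open>c\<^sub>n\<^sub>+\<^sub>2 + n c\<^sub>n = (2n + 3) c\<^sub>n\<^sub>+\<^sub>1\<close>, which is the differential equation.

  The coefficient of \<open>z\<^sup>n\<close> in \<open>C\<^sub>1'\<close> is \<open>2\<^sup>n\<close> times the convolution of \<open>(1/4)\<^sup>k / k!\<close> with
  \<open>b\<^sub>n = (5/4)\<^sub>n / n!\<close>. Since \<open>b\<close> increases while \<open>b\<^sub>n / n\<close> decreases, \<open>b\<^sub>n\<^sub>-\<^sub>k / b\<^sub>n\<close> lies between
  \<open>1 - k/n\<close> and 1, so that the convolution is \<open>e\<^sup>1\<^sup>/\<^sup>4 b\<^sub>n (1 + O(1/n))\<close>. The logarithmic convexity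
  of the Gamma function gives the asymptotics of \<open>b\<^sub>n\<close>.
\<close>

section \<open>Counting compacted trees\<close>

lemma length_takeWhile_neq_inject:
  assumes "length (takeWhile (\<lambda>t. t \<noteq> x) s) = length (takeWhile (\<lambda>t. t \<noteq> y) s)"
    and "x \<in> set s" "y \<in> set s"
  shows "x = y"
  using assms by (induction s) (auto split: if_splits)

text \<open>The output can be decoded from left to right: a pointer gives the position of the tree
  in \<open>s\<close>, and a decoded left subtree fixes the list against which the right one is
  compacted. Hence \<open>s\<close> varies in the induction.\<close>

lemma inj_fst_compact_aux: "fst (compact_aux T s) = fst (compact_aux U s) \<Longrightarrow> T = U"
proof (induction T arbitrary: U s)
  case FLeaf
  have "U = FLeaf" if "FLeaf \<notin> set s"
    using FLeaf that by (cases U) (auto split: if_splits prod.splits)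
  moreover have "U = FLeaf" if "FLeaf \<in> set s"
  proof -
    have eq: "length (takeWhile (\<lambda>t. t \<noteq> FLeaf) s) = length (takeWhile (\<lambda>t. t \<noteq> U) s)"
      and "U \<in> set s"
      using FLeaf that by (cases U; auto split: if_splits prod.splits)+
    with that show ?thesis using length_takeWhile_neq_inject by metis
  qed
  ultimately show ?case by blast
next
  case (FNode l r)
  show ?case
  proof (cases "FNode l r \<in> set s")
    case True
    then have eq: "length (takeWhile (\<lambda>t. t \<noteq> FNode l r) s) = length (takeWhile (\<lambda>t. t \<noteq> U) s)"
      and "U \<in> set s"
      using FNode.prems by (cases U; auto split: if_splits prod.splits)+
    with True show ?thesis using length_takeWhile_neq_inject by metis
  next
    case False
    then obtain l' r' where U: "U = FNode l' r'" and "FNode l' r' \<notin> set s"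
      using FNode.prems by (cases U) (auto split: if_splits prod.splits)
    with False FNode.prems
    have "fst (compact_aux l s) = fst (compact_aux l' s)"
      and r: "fst (compact_aux r (snd (compact_aux l s))) = fst (compact_aux r' (snd (compact_aux l' s)))"
      by (auto split: prod.splits)
    then have "l = l'" using FNode.IH(1) by blast
    with r FNode.IH(2) U show ?thesis by auto
  qed
qed

text \<open>Post-order finishes the leftmost leaf first, after which both runs hold the same
  list.\<close>

lemma snd_compact_aux_Nil: "snd (compact_aux T []) = snd (compact_aux T [FLeaf])"
  by (induction T) (auto split: prod.splits)

text \<open>The leftmost leaf becomes \<open>CLeaf\<close> in one run and \<open>Pointer 0\<close>
  in the other; the spine keeps neither.\<close>

lemma spine_compact_aux_Nil:
  "spine (fst (compact_aux T [])) = spine (fst (compact_aux T [FLeaf]))"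
proof (induction T)
  case (FNode l r)
  then show ?case
    using snd_compact_aux_Nil[of l] by (auto split: prod.splits)
qed simp

lemma internal_nodes_eq_size: "internal_nodes C = size (spine C)"
  by (induction C) auto

text \<open>
  For a nonempty tree this is one more than the right height. The shift makes the empty tree the only
  one of rank 0, so that bounding the rank of \<open>Node l x r\<close> by \<open>Suc m\<close> bounds that of \<open>r\<close> by \<open>m\<close>.
\<close>

fun tree_rank :: "'a tree \<Rightarrow> nat" where
  "tree_rank Leaf = 0"
| "tree_rank (Node l x r) = max (tree_rank l) (Suc (tree_rank r))"

lemma finite_node_paths [simp]: "finite (node_paths t)"
  by (induction t) auto

lemma right_height_le_iff: "right_height t \<le> h \<longleftrightarrow> (\<forall>p\<in>node_paths t. count_list p True \<le> h)"
  unfolding right_height_def by (subst Max_le_iff) auto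

lemma right_height_le_iff_rank: "right_height t \<le> h \<longleftrightarrow> tree_rank t \<le> Suc h"
proof (induction t arbitrary: h)
  case Leaf
  then show ?case by (simp add: right_height_le_iff)
next
  case (Node l x r)
  \<comment> \<open>\<open>Suc\<close> accounts for the right edge into \<open>r\<close>. For
    \<open>h = 0\<close> it forbids every node of \<open>r\<close>, which is rank 0.\<close>
  have "(\<forall>p\<in>node_paths r. Suc (count_list p True) \<le> h) \<longleftrightarrow> tree_rank r \<le> h"
  proof (cases h)
    case 0
    then show ?thesis by (cases r) auto
  next
    case (Suc h')
    then show ?thesis using Node.IH(2)[of h'] by (simp add: right_height_le_iff)
  qed
  with Node.IH(1)[of h] show ?case
    by (simp add: right_height_le_iff ball_Un)
qed

text \<open>
  The invariant of the list of seen subtrees. It fails for the initial list \<open>[]\<close>, which is why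
  the compaction is started from \<open>[FLeaf]\<close>; this does not affect the spine.
\<close>

definition closed_list :: "full_tree list \<Rightarrow> bool" where
  "closed_list s \<longleftrightarrow> distinct s \<and> FLeaf \<in> set s \<and>
     (\<forall>l r. FNode l r \<in> set s \<longrightarrow> l \<in> set s \<and> r \<in> set s)"

lemma closed_listD:
  assumes "closed_list s" "FNode l r \<in> set s"
  shows "l \<in> set s" "r \<in> set s"
  using assms unfolding closed_list_def by blast+

lemma closed_list_imp_distinct: "closed_list s \<Longrightarrow> distinct s"
  and closed_list_imp_FLeaf: "closed_list s \<Longrightarrow> FLeaf \<in> set s"
  unfolding closed_list_def by blast+

section \<open>Growth of the list of seen subtrees\<close>

lemma compact_aux_seen:
  assumes "T \<in> set s"
  shows "snd (compact_aux T s) = s" "spine (fst (compact_aux T s)) = Leaf"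
proof -
  show "snd (compact_aux T s) = s" by (cases T) (use assms in simp_all)
  show "spine (fst (compact_aux T s)) = Leaf" by (cases T) (use assms in simp_all)
qed

lemma compact_aux_unseen:
  assumes "FNode l r \<notin> set s"
  shows "snd (compact_aux (FNode l r) s) = snd (compact_aux r (snd (compact_aux l s))) @ [FNode l r]"
    and "spine (fst (compact_aux (FNode l r) s)) =
           Node (spine (fst (compact_aux l s))) () (spine (fst (compact_aux r (snd (compact_aux l s)))))"
  using assms by (auto split: prod.splits)

text \<open>The size bound shows that compacting the children of a node cannot enter the node
  itself, so that appending it keeps the list distinct.\<close>

lemma set_compact_aux:
  "set s \<subseteq> set (snd (compact_aux T s))"
  "t \<in> set (snd (compact_aux T s)) \<Longrightarrow> t \<in> set s \<or> size t \<le> size T"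
  "T \<in> set (snd (compact_aux T s))"
proof (induction T arbitrary: s t)
  case FLeaf
  { case 1 show ?case by auto }
  { case 2 then show ?case by (auto split: if_splits) }
  { case 3 show ?case by auto }
next
  case (FNode l r)
  have set_eq: "set (snd (compact_aux (FNode l r) s)) =
      insert (FNode l r) (set (snd (compact_aux r (snd (compact_aux l s)))))"
    if "FNode l r \<notin> set s" for s
    using compact_aux_unseen(1)[OF that] by simp
  have seen: "set (snd (compact_aux (FNode l r) s)) = set s" if "FNode l r \<in> set s" for s
    using that by simp
  { case 1 show ?case
      using FNode.IH(1)[of s] FNode.IH(4)[of "snd (compact_aux l s)"]
      by (cases "FNode l r \<in> set s") (auto simp: seen set_eq simp del: compact_aux.simps) }
  { case 2 show ?case
    proof (cases "FNode l r \<in> set s")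
      case True
      with 2 show ?thesis by simp
    next
      case False
      with 2 have "t = FNode l r \<or> t \<in> set (snd (compact_aux r (snd (compact_aux l s))))"
        by (simp add: set_eq del: compact_aux.simps)
      then show ?thesis
        using FNode.IH(2)[of t s] FNode.IH(5)[of t "snd (compact_aux l s)"] by auto
    qed }
  { case 3 show ?case
      by (cases "FNode l r \<in> set s") (simp_all add: seen set_eq del: compact_aux.simps) }
qed

lemma closed_list_compact_aux:
  assumes "closed_list s"
  shows "closed_list (snd (compact_aux T s))"
  using assms
proof (induction T arbitrary: s)
  case FLeaf
  then have "FLeaf \<in> set s" by (rule closed_list_imp_FLeaf)
  with FLeaf show ?case by simp
next
  case (FNode l r)
  show ?case
  proof (cases "FNode l r \<in> set s")
    case True
    with FNode.prems show ?thesis by (simp add: compact_aux_seen)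
  next
    case False
    define s1 where "s1 = snd (compact_aux l s)"
    define s2 where "s2 = snd (compact_aux r s1)"
    have s2: "closed_list s2"
      unfolding s1_def s2_def by (rule FNode.IH(2)[OF FNode.IH(1)[OF FNode.prems]])
    have new: "FNode l r \<notin> set s2"
      using False set_compact_aux(2)[of "FNode l r" l s] set_compact_aux(2)[of "FNode l r" r s1]
      unfolding s1_def s2_def by auto
    have lr: "l \<in> set s2" "r \<in> set s2"
      using set_compact_aux(3)[of l s] set_compact_aux(1)[of s1 r] set_compact_aux(3)[of r s1]
      unfolding s1_def s2_def by auto
    have "snd (compact_aux (FNode l r) s) = s2 @ [FNode l r]"
      unfolding s1_def s2_def by (rule compact_aux_unseen(1)[OF False])
    moreover have "closed_list (s2 @ [FNode l r])"
    proof -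
      have "distinct (s2 @ [FNode l r])" "FLeaf \<in> set (s2 @ [FNode l r])"
        using closed_list_imp_distinct[OF s2] closed_list_imp_FLeaf[OF s2] new by simp_all
      moreover have "x \<in> set (s2 @ [FNode l r]) \<and> y \<in> set (s2 @ [FNode l r])"
        if "FNode x y \<in> set (s2 @ [FNode l r])" for x y
        using that lr closed_listD[OF s2, of x y] by auto
      ultimately show ?thesis unfolding closed_list_def by blast
    qed
    ultimately show ?thesis by (simp only:)
  qed
qed

text \<open>As the leaf is already in \<open>s\<close>, only internal nodes are appended, one for
  each spine node.\<close>

lemma length_compact_aux:
  assumes "closed_list s"
  shows "length (snd (compact_aux T s)) = length s + size (spine (fst (compact_aux T s)))"
  using assms
proof (induction T arbitrary: s)
  case FLeaf
  then have "FLeaf \<in> set s" by (rule closed_list_imp_FLeaf)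
  with FLeaf show ?case by simp
next
  case (FNode l r)
  show ?case
  proof (cases "FNode l r \<in> set s")
    case True
    then show ?thesis by (simp add: compact_aux_seen)
  next
    case False
    then show ?thesis
      using FNode.IH(1)[OF FNode.prems] FNode.IH(2)[OF closed_list_compact_aux[OF FNode.prems, of l]]
      by (simp add: compact_aux_unseen del: compact_aux.simps)
  qed
qed

section \<open>Counting the trees that extend a list of seen subtrees\<close>

definition extensions :: "nat \<Rightarrow> full_tree list \<Rightarrow> nat \<Rightarrow> full_tree set" where
  "extensions m s n = {T. size (spine (fst (compact_aux T s))) = n \<and>
     tree_rank (spine (fst (compact_aux T s))) \<le> m}"

text \<open>
  The subtracted \<open>k - 1\<close> is the number of internal nodes among \<open>k\<close> seen subtrees, each of which
  rules out one pair of children.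
\<close>

fun extension_count :: "nat \<Rightarrow> nat \<Rightarrow> nat \<Rightarrow> nat" where
  "extension_count m k 0 = k"
| "extension_count 0 k (Suc n) = 0"
| "extension_count (Suc m) k (Suc n) =
     (\<Sum>i\<le>n. extension_count (Suc m) k i * extension_count m (k + i) (n - i)) -
     (if n = 0 then k - 1 else 0)"

lemma size_spine_eq_0_iff:
  assumes "FLeaf \<in> set s"
  shows "size (spine (fst (compact_aux T s))) = 0 \<longleftrightarrow> T \<in> set s"
  by (cases T) (use assms in \<open>auto split: prod.splits\<close>)

lemma extensions_0: 
  assumes "FLeaf \<in> set s"
  shows "extensions m s 0 = set s"
  using size_spine_eq_0_iff[OF assms] compact_aux_seen(2)
  by (auto simp: extensions_def)

lemma extensions_rank_0: "extensions 0 s (Suc n) = {}"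
proof -
  have "size t = 0" if "tree_rank t \<le> 0" for t :: "unit tree"
    using that by (cases t) auto
  then show ?thesis by (force simp: extensions_def)
qed

text \<open>The right child sees the list left behind by the left child, and its edge uses up one
  unit of rank. Trees in \<open>s\<close> are removed because they become pointers.\<close>

lemma extensions_Suc:
  assumes "FLeaf \<in> set s"
  shows "extensions (Suc m) s (Suc n) =
    case_prod FNode ` (\<Union>i\<le>n. SIGMA l:extensions (Suc m) s i. extensions m (snd (compact_aux l s)) (n - i))
      - set s" (is "?L = ?R")
proof (intro equalityI subsetI)
  fix T assume T: "T \<in> ?L"
  then have "T \<notin> set s" using compact_aux_seen(2)[of T s] by (auto simp: extensions_def)
  moreover from this obtain l r where "T = FNode l r" using assms by (metis full_tree.exhaust)
  ultimately show "T \<in> ?R"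
    using T assms by (force simp: extensions_def compact_aux_unseen simp del: compact_aux.simps)
next
  fix T assume T: "T \<in> ?R"
  then show "T \<in> ?L"
    using assms by (auto simp: extensions_def compact_aux_unseen simp del: compact_aux.simps)
qed

text \<open>The count depends on \<open>s\<close> only through its length: every left child with
  \<open>i\<close> new nodes leaves a list longer by \<open>i\<close>, so the number of right
  children is the same for all of them.\<close>

lemma card_extensions:
  assumes "closed_list s"
  shows "finite (extensions m s n) \<and> card (extensions m s n) = extension_count m (length s) n"
  using assms
proof (induction m "length s" n arbitrary: s rule: extension_count.induct)
  case (1 m)
  then show ?case by (simp add: extensions_0 closed_list_imp_FLeaf closed_list_imp_distinct distinct_card)
next
  case (2 n)
  then show ?case by (simp add: extensions_rank_0)
next
  case (3 m n)
  have leaf: "FLeaf \<in> set s" and dist: "distinct s"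
    using closed_list_imp_FLeaf closed_list_imp_distinct 3(3) by blast+
  \<comment> \<open>Pairs of children in which the left one contributes \<open>i\<close> of the
    \<open>n\<close> new nodes.\<close>
  define P where "P i = (SIGMA l:extensions (Suc m) s i. extensions m (snd (compact_aux l s)) (n - i))" for i
  have fin1: "finite (extensions (Suc m) s i)"
    and card1: "card (extensions (Suc m) s i) = extension_count (Suc m) (length s) i" if "i \<le> n" for i
    using 3(1)[of i s] 3(3) that by simp_all
  have inner: "finite (extensions m (snd (compact_aux l s)) (n - i)) \<and>
     card (extensions m (snd (compact_aux l s)) (n - i)) = extension_count m (length s + i) (n - i)"
    if "i \<le> n" "l \<in> extensions (Suc m) s i" for i l
  proof -
    have "length (snd (compact_aux l s)) = length s + i"
      using length_compact_aux[OF 3(3)] that by (simp add: extensions_def)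
    with 3(2)[of i "snd (compact_aux l s)"] that closed_list_compact_aux[OF 3(3)] show ?thesis
      by simp
  qed
  have finP: "finite (P i)" if "i \<le> n" for i
    unfolding P_def using fin1 inner that by (intro finite_SigmaI) auto
  have cardP: "card (P i) = extension_count (Suc m) (length s) i * extension_count m (length s + i) (n - i)"
    if "i \<le> n" for i
  proof -
    have "card (P i) = (\<Sum>l\<in>extensions (Suc m) s i. extension_count m (length s + i) (n - i))"
      unfolding P_def using fin1 inner that by (subst card_SigmaI) auto
    with card1 that show ?thesis by simp
  qed
  have "P i \<inter> P j = {}" if "i \<noteq> j" for i j
    using that by (auto simp: P_def extensions_def)
  then have cardU: "card (\<Union>i\<le>n. P i) =
      (\<Sum>i\<le>n. extension_count (Suc m) (length s) i * extension_count m (length s + i) (n - i))"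
    using finP cardP by (subst card_UN_disjoint) auto
  have inj: "inj_on (case_prod FNode) A" for A by (auto simp: inj_on_def)
  have "card (case_prod FNode ` (\<Union>i\<le>n. P i) \<inter> set s) = (if n = 0 then length s - 1 else 0)"
  proof (cases n)
    case 0
    \<comment> \<open>Without new nodes below, both children are pointers. By closure every seen
      internal node arises from such a pair; only the leaf does not.\<close>
    have "case_prod FNode ` (\<Union>i\<le>n. P i) \<inter> set s = set s - {FLeaf}"
    proof (intro equalityI subsetI)
      fix T assume T: "T \<in> set s - {FLeaf}"
      then obtain l r where lr: "T = FNode l r" by (metis DiffD2 full_tree.exhaust singletonI)
      with T have "l \<in> set s" "r \<in> set s" using closed_listD[OF 3(3), of l r] by simp_all
      then have "(l, r) \<in> P 0"
        using 0 leaf by (simp add: P_def extensions_0 compact_aux_seen)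
      then have "T \<in> case_prod FNode ` (\<Union>i\<le>n. P i)"
        unfolding lr by (intro image_eqI[where x = "(l, r)"]) auto
      with T show "T \<in> case_prod FNode ` (\<Union>i\<le>n. P i) \<inter> set s" by simp
    qed auto
    with 0 dist leaf show ?thesis by (simp add: distinct_card)
  next
    case (Suc n')
    \<comment> \<open>The children of a seen node are seen, so they contribute no new nodes, whereas
      \<open>n > 0\<close> are required.\<close>
    have False if lr: "(l, r) \<in> P i" "i \<le> n" "FNode l r \<in> set s" for l r i
    proof -
      have "l \<in> set s" "r \<in> set s" using closed_listD[OF 3(3) lr(3)] .
      with lr leaf have "i = 0" "n - i = 0"
        by (auto simp: P_def extensions_def compact_aux_seen)
      with Suc show False by simp
    qed
    then have "case_prod FNode ` (\<Union>i\<le>n. P i) \<inter> set s = {}" by auto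
    with Suc show ?thesis by simp
  qed
  moreover have "extensions (Suc m) s (Suc n) = case_prod FNode ` (\<Union>i\<le>n. P i) - set s"
    unfolding P_def by (rule extensions_Suc[OF leaf])
  moreover have "finite (\<Union>i\<le>n. P i)" using finP by auto
  ultimately show ?case
    using cardU by (simp add: card_Diff_subset_Int card_image[OF inj])
qed

lemma compacted_count_eq_extension_count: "compacted_count h n = extension_count (Suc h) 1 n"
proof -
  have inj: "inj compacted" by (auto intro!: injI inj_fst_compact_aux simp: compacted_def)
  have "{C \<in> range compacted. internal_nodes C = n \<and> right_height (spine C) \<le> h}
      = compacted ` extensions (Suc h) [FLeaf] n"
    by (auto simp: extensions_def right_height_le_iff_rank internal_nodes_eq_size
          compacted_def spine_compact_aux_Nil)
  then show ?thesis
    using card_extensions[of "[FLeaf]" "Suc h" n] inj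
    by (simp add: compacted_count_def card_image inj_on_subset closed_list_def)
qed

section \<open>The recurrence for right height at most 1\<close>

lemma extension_count_1_Suc_Suc:
  "extension_count 1 k (Suc (Suc n)) = (k + Suc n) * extension_count 1 k (Suc n)"
proof -
  \<comment> \<open>At rank 1 the right child must be a pointer, so only \<open>i = Suc n\<close>
    survives; the pointer then has \<open>k + Suc n\<close> targets.\<close>
  have "extension_count 0 k' (Suc n - i) = 0" if "i \<le> n" for i k'
    using that by (simp add: Suc_diff_le)
  then show ?thesis by simp
qed

lemma compacted_count_0: "compacted_count 1 0 = 1"
  and compacted_count_1: "compacted_count 1 (Suc 0) = 1"
  by (simp_all add: compacted_count_eq_extension_count)

text \<open>With only the leaf seen, the correction \<open>k - 1\<close> of
  \<open>extension_count\<close> is 0.\<close>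

lemma compacted_count_Suc:
  "compacted_count 1 (Suc n) = (\<Sum>i\<le>n. compacted_count 1 i * extension_count 1 (Suc i) (n - i))"
  by (simp add: compacted_count_eq_extension_count)

text \<open>Enlarging the right subtree by one node multiplies its count by \<open>n + 1\<close>,
  whatever the size \<open>i\<close> of the left one. The convolution for \<open>?c (n + 2)\<close>
  thus reduces to the one for \<open>?c (n + 1)\<close>.\<close>

lemma compacted_count_rec:
  "compacted_count 1 (Suc (Suc n)) + n * compacted_count 1 n =
     (2 * n + 3) * compacted_count 1 (Suc n)"
proof -
  let ?c = "compacted_count 1" and ?e = "extension_count 1"
  have "(\<Sum>i\<le>n. ?c i * ?e (Suc i) (Suc n - i)) + n * ?c n
      = (\<Sum>i<n. ?c i * ?e (Suc i) (Suc n - i)) + ?c n * (?e (Suc n) 1 + n)"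
    by (simp add: lessThan_Suc_atMost[symmetric] algebra_simps)
  \<comment> \<open>At \<open>i = n\<close> the right subtree grows from a pointer to a single node,
    which excludes \<open>n\<close> pairs; adding them back restores the factor
    \<open>n + 1\<close>.\<close>
  also have "?e (Suc n) 1 + n = Suc n * ?e (Suc n) 0" by simp
  also have "(\<Sum>i<n. ?c i * ?e (Suc i) (Suc n - i)) = (\<Sum>i<n. Suc n * (?c i * ?e (Suc i) (n - i)))"
  proof (rule sum.cong)
    fix i assume "i \<in> {..<n}"
    then obtain j where "n = Suc (i + j)" by (auto dest: less_imp_Suc_add)
    then show "?c i * ?e (Suc i) (Suc n - i) = Suc n * (?c i * ?e (Suc i) (n - i))"
      using extension_count_1_Suc_Suc[of "Suc i" j]
      by (simp add: Suc_diff_le mult_ac del: extension_count.simps)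
  qed simp
  also have "\<dots> + ?c n * (Suc n * ?e (Suc n) 0) = Suc n * ?c (Suc n)"
    unfolding compacted_count_Suc[of n] 
    by (simp add: lessThan_Suc_atMost[symmetric] sum_distrib_left algebra_simps)
  finally have "(\<Sum>i\<le>n. ?c i * ?e (Suc i) (Suc n - i)) + n * ?c n = Suc n * ?c (Suc n)" .
  \<comment> \<open>The remaining term \<open>i = n + 1\<close> has a pointer on the right and
    contributes \<open>(n + 2) * ?c (n + 1)\<close>.\<close>
  then show ?thesis
    by (subst compacted_count_Suc) (simp add: algebra_simps)
qed

section \<open>The generating function\<close>

lemma fps_ODE_nth_0:
  fixes F :: "'a :: field_char_0 fps"
  assumes "(1 - 2 * fps_X) * fps_deriv F = (3 - fps_X) * F"
  shows "fps_nth F (Suc 0) = 3 * fps_nth F 0"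
  using arg_cong[OF assms, of "\<lambda>F. fps_nth F 0"]
  by (simp add: fps_numeral_fps_const algebra_simps)

lemma fps_ODE_nth_Suc:
  fixes F :: "'a :: field_char_0 fps"
  assumes "(1 - 2 * fps_X) * fps_deriv F = (3 - fps_X) * F"
  shows "fps_nth F (Suc (Suc n)) =
    ((2 * of_nat n + 5) * fps_nth F (Suc n) - fps_nth F n) / of_nat (Suc (Suc n))"
proof -
  have "of_nat (Suc (Suc n)) * fps_nth F (Suc (Suc n)) =
      (2 * of_nat n + 5) * fps_nth F (Suc n) - fps_nth F n"
    using arg_cong[OF assms, of "\<lambda>F. fps_nth F (Suc n)"]
    by (simp add: left_diff_distrib mult.assoc fps_mult_numeral_left) (simp add: algebra_simps)
  then show ?thesis by (simp add: field_simps del: of_nat_Suc)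
qed

lemma fps_ODE_unique:
  fixes F G :: "'a :: field_char_0 fps"
  assumes F: "(1 - 2 * fps_X) * fps_deriv F = (3 - fps_X) * F"
    and G: "(1 - 2 * fps_X) * fps_deriv G = (3 - fps_X) * G"
    and "fps_nth F 0 = fps_nth G 0"
  shows "F = G"
proof (rule fps_ext)
  fix n
  show "fps_nth F n = fps_nth G n"
  proof (induction n rule: induct_nat_012)
    case 0
    show ?case by fact
  next
    case 1
    show ?case using assms(3) by (simp add: fps_ODE_nth_0[OF F] fps_ODE_nth_0[OF G])
  next
    case (ge2 n)
    then show ?case by (simp add: fps_ODE_nth_Suc[OF F] fps_ODE_nth_Suc[OF G])
  qed
qed

text \<open>The expansion of \<open>(1 - 2 * z) powr (- (5 / 4))\<close>.\<close>

definition binomial_series :: "'a :: field_char_0 fps" where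
  "binomial_series = Abs_fps (\<lambda>n. 2 ^ n * pochhammer (5 / 4) n / fact n)"

lemma binomial_series_ODE:
  "(1 - 2 * fps_X) * fps_deriv binomial_series = fps_const (5 / 2 :: 'a :: field_char_0) * binomial_series"
proof (rule fps_ext)
  fix n
  let ?B = "binomial_series :: 'a fps"
  have step: "of_nat (Suc n) * fps_nth ?B (Suc n) = (2 * of_nat n + 5 / 2) * fps_nth ?B n" for n
    by (simp add: binomial_series_def pochhammer_Suc divide_simps algebra_simps del: of_nat_Suc)
  show "fps_nth ((1 - 2 * fps_X) * fps_deriv ?B) n = fps_nth (fps_const (5 / 2) * ?B) n"
    using step[of n]
    by (cases n) (simp_all add: left_diff_distrib mult.assoc fps_mult_numeral_left, simp_all add: algebra_simps)
qed

text \<open>The logarithmic derivative is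
  \<open>1/2 + (5/2) / (1 - 2 * z) = (3 - z) / (1 - 2 * z)\<close>.\<close>

lemma exp_binomial_series_ODE:
  fixes G :: "'a :: field_char_0 fps"
  defines "G \<equiv> fps_exp (1 / 2) * binomial_series"
  shows "(1 - 2 * fps_X) * fps_deriv G = (3 - fps_X) * G"
proof -
  have "(1 - 2 * fps_X) * fps_deriv G = fps_const (1 / 2) * (1 - 2 * fps_X) * G
      + fps_exp (1 / 2) * ((1 - 2 * fps_X) * fps_deriv binomial_series)"
    by (simp add: G_def algebra_simps)
  also have "\<dots> = (fps_const (1 / 2) * (1 - 2 * fps_X) + fps_const (5 / 2)) * G"
    unfolding binomial_series_ODE by (simp only: G_def algebra_simps)
  also have "fps_const (1 / 2) * (1 - 2 * fps_X) + fps_const (5 / 2) = (3 - fps_X :: 'a fps)"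
  proof -
    have "fps_const (1 / 2) * (2 * fps_X) = (fps_X :: 'a fps)"
      "fps_const (1 / 2) + fps_const (5 / 2) = (3 :: 'a fps)"
      by (simp_all add: fps_numeral_fps_const flip: mult.assoc)
    then show ?thesis by (simp add: algebra_simps)
  qed
  finally show ?thesis .
qed

text \<open>At coefficient \<open>n\<close> this is \<open>compacted_count_rec\<close> divided by
  \<open>fact n\<close>. The factor \<open>n\<close> before \<open>c_n\<close> turns
  \<open>1 / fact n\<close> into \<open>1 / fact (n - 1)\<close>, as multiplication by
  \<open>fps_X\<close> requires; for \<open>n = 0\<close> that term vanishes.\<close>

lemma compacted_count_series_ODE:
  fixes F :: "'a :: field_char_0 fps"
  defines "F \<equiv> Abs_fps (\<lambda>n. of_nat (compacted_count 1 (Suc n)) / fact n)"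
  shows "(1 - 2 * fps_X) * fps_deriv F = (3 - fps_X) * F"
proof (rule fps_ext)
  fix n
  have rec: "of_nat (compacted_count 1 (Suc (Suc n))) + of_nat n * of_nat (compacted_count 1 n) =
     (2 * of_nat n + 3) * (of_nat (compacted_count 1 (Suc n)) :: 'a)" for n
    using arg_cong[OF compacted_count_rec[of n], of "of_nat :: nat \<Rightarrow> 'a"] by simp
  show "fps_nth ((1 - 2 * fps_X) * fps_deriv F) n = fps_nth ((3 - fps_X) * F) n"
  proof (cases n)
    case 0
    with rec[of 0] show ?thesis by (simp add: F_def fps_numeral_fps_const algebra_simps)
  next
    case (Suc k)
    define a1 a2 a3 f :: 'a where "a1 = of_nat (compacted_count 1 (Suc k))"
      and "a2 = of_nat (compacted_count 1 (Suc (Suc k)))"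
      and "a3 = of_nat (compacted_count 1 (Suc (Suc (Suc k))))" and "f = fact (Suc k)"
    have a3: "a3 = (2 * of_nat (Suc k) + 3) * a2 - of_nat (Suc k) * a1"
      using rec[of "Suc k"] by (simp only: a1_def a2_def a3_def eq_diff_eq)
    have "f \<noteq> 0" unfolding f_def by (rule fact_nonzero)
    have "1 + of_nat k \<noteq> (0 :: 'a)" by (metis of_nat_Suc of_nat_neq_0)
    then have nth: "of_nat (Suc (Suc k)) * fps_nth F (Suc (Suc k)) = a3 / f"
      "fps_nth F (Suc k) = a2 / f" "fps_nth F k = of_nat (Suc k) * a1 / f"
      by (simp_all add: F_def a1_def a2_def a3_def f_def divide_simps del: of_nat_Suc)
    have "fps_nth ((1 - 2 * fps_X) * fps_deriv F) n =
        of_nat (Suc (Suc k)) * fps_nth F (Suc (Suc k)) - 2 * (of_nat (Suc k) * fps_nth F (Suc k))"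
      by (simp add: Suc left_diff_distrib mult.assoc fps_mult_numeral_left)
    also have "\<dots> = 3 * fps_nth F (Suc k) - fps_nth F k"
      unfolding nth a3 using \<open>f \<noteq> 0\<close> by (simp add: divide_simps) (simp add: algebra_simps)
    also have "\<dots> = fps_nth ((3 - fps_X) * F) n"
      by (simp add: Suc left_diff_distrib mult.assoc fps_mult_numeral_left)
    finally show ?thesis .
  qed
qed

text \<open>The field stays general: the analytic expansion needs complex coefficients, the
  asymptotics real ones.\<close>

lemma compacted_count_series_eq:
  "Abs_fps (\<lambda>n. of_nat (compacted_count 1 (Suc n)) / fact n) =
     fps_exp (1 / 2 :: 'a :: field_char_0) * binomial_series"
  by (rule fps_ODE_unique[OF compacted_count_series_ODE exp_binomial_series_ODE])
     (use compacted_count_1 in \<open>simp add: binomial_series_def\<close>)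

lemma fps_deriv_compacted_egf:
  "fps_deriv (compacted_egf k) = Abs_fps (\<lambda>n. of_nat (compacted_count k (Suc n)) / fact n)"
  by (rule fps_ext) (simp add: compacted_egf_def divide_simps del: of_nat_Suc)

section \<open>Analytic expansion and D-finiteness\<close>

lemma has_fps_expansion_binomial_series:
  "(\<lambda>z. (1 - 2 * z) powr (- (5 / 4))) has_fps_expansion (binomial_series :: complex fps)"
proof (rule has_fps_expansionI)
  have "eventually (\<lambda>z :: complex. z \<in> ball 0 (1 / 2)) (nhds 0)"
    by (rule eventually_nhds_in_open) auto
  then show "eventually (\<lambda>z :: complex. (\<lambda>n. fps_nth binomial_series n * z ^ n) sums
      (1 - 2 * z) powr (- (5 / 4))) (nhds 0)"
  proof eventually_elim
    case (elim z)
    then have "(\<lambda>n. ((- (5 / 4)) gchoose n) * (- 2 * z) ^ n) sums (1 + (- 2 * z)) powr (- (5 / 4))"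
      by (intro gen_binomial_complex) (simp add: norm_mult)
    \<comment> \<open>The binomial coefficient is
      \<open>(- 1) ^ n * pochhammer (5 / 4) n / fact n\<close>; its sign cancels that of
      \<open>(- 2 * z) ^ n\<close>.\<close>
    moreover have "((- (5 / 4)) gchoose n) * (- 2 * z) ^ n = fps_nth binomial_series n * z ^ n" for n
    proof -
      have "(- 2 * z) ^ n = (- 1 * (2 * z)) ^ n" by simp
      also have "\<dots> = (- 1) ^ n * (2 ^ n * z ^ n)" by (simp only: power_mult_distrib)
      finally show ?thesis
        by (cases "even n") (simp_all add: gbinomial_pochhammer binomial_series_def mult_ac)
    qed
    ultimately show ?case by simp
  qed
qed

lemma D_finite_if_ODE:
  fixes F :: "'a :: field_char_0 fps"
  assumes "(1 - 2 * fps_X) * fps_deriv (fps_deriv F) - (3 - fps_X) * fps_deriv F = 0"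
  shows "D_finite F"
proof -
  define p :: "nat \<Rightarrow> 'a poly" where
    "p = (\<lambda>i. if i = 0 then 0 else if i = 1 then [:- 3, 1:] else [:1, - 2:])"
  have p: "fps_of_poly (p 0) = 0" "fps_of_poly (p 1) = - (3 - fps_X)"
      "fps_of_poly (p 2) = 1 - 2 * fps_X"
    by (simp_all add: p_def fps_of_poly_pCons fps_numeral_fps_const flip: fps_const_neg)
  have "(\<Sum>i\<le>2. fps_of_poly (p i) * (fps_deriv ^^ i) F) =
      fps_of_poly (p 0) * F + fps_of_poly (p 1) * fps_deriv F + fps_of_poly (p 2) * fps_deriv (fps_deriv F)"
    by (simp add: numeral_2_eq_2)
  also have "\<dots> = 0" unfolding p using assms by (simp add: algebra_simps)
  finally have "(\<Sum>i\<le>2. fps_of_poly (p i) * (fps_deriv ^^ i) F) = 0" .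
  moreover have "p 2 \<noteq> 0" by (simp add: p_def)
  ultimately show ?thesis unfolding D_finite_def by blast
qed

section \<open>Asymptotics\<close>

text \<open>The coefficients of \<open>(1 - z) powr (- (5 / 4))\<close>, that is, those of
  \<open>binomial_series\<close> without the exponential growth \<open>2 ^ n\<close>.\<close>

definition bcoeff :: "nat \<Rightarrow> real" where "bcoeff n = pochhammer (5 / 4) n / fact n"

lemma bcoeff_pos: "bcoeff n > 0"
  by (simp add: bcoeff_def pochhammer_pos)

lemma bcoeff_Suc: "bcoeff (Suc n) = (real n + 5 / 4) / (real n + 1) * bcoeff n"
  by (simp add: bcoeff_def pochhammer_Suc mult_ac add_ac)

lemma mono_bcoeff: "mono bcoeff"
proof (rule incseq_SucI)
  fix n
  have "1 * bcoeff n \<le> (real n + 5 / 4) / (real n + 1) * bcoeff n"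
    by (intro mult_right_mono less_imp_le[OF bcoeff_pos]) (simp add: field_simps)
  then show "bcoeff n \<le> bcoeff (Suc n)" by (simp add: bcoeff_Suc)
qed

lemma bcoeff_div_antimono:
  assumes "0 < j" "j \<le> n"
  shows "bcoeff n / n \<le> bcoeff j / j"
  using assms(2)
proof (induction n rule: dec_induct)
  case (step n)
  \<comment> \<open>The ratio of consecutive values of \<open>bcoeff n / n\<close> is
    \<open>n * (n + 5/4) / (n + 1)^2\<close>.\<close>
  have "real n * (real n + 5 / 4) \<le> (real n + 1) * (real n + 1)"
    by (simp add: algebra_simps)
  then have "(real n + 5 / 4) / (real n + 1) / Suc n \<le> 1 / n"
    using step(1) assms(1) by (simp add: pos_divide_le_eq pos_le_divide_eq mult_ac add_ac)
  from mult_right_mono[OF this less_imp_le[OF bcoeff_pos[of n]]]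
  have "bcoeff (Suc n) / Suc n \<le> bcoeff n / n"
    by (simp add: bcoeff_Suc)
  with step.IH show ?case by linarith
qed simp

lemma bcoeff_bounds:
  assumes "n > 0" "k \<le> n"
  shows "(1 - k / n) * bcoeff n \<le> bcoeff (n - k)" "bcoeff (n - k) \<le> bcoeff n"
proof -
  show "bcoeff (n - k) \<le> bcoeff n" by (rule monoD[OF mono_bcoeff]) simp
  show "(1 - k / n) * bcoeff n \<le> bcoeff (n - k)"
  proof (cases "k = n")
    case True
    with assms show ?thesis by (simp add: less_imp_le[OF bcoeff_pos])
  next
    case False
    with assms have "bcoeff n / n \<le> bcoeff (n - k) / (n - k)"
      by (intro bcoeff_div_antimono) auto
    then have "bcoeff n / n * real (n - k) \<le> bcoeff (n - k)"
      using assms False by (simp add: pos_le_divide_eq)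
    also have "bcoeff n / n * real (n - k) = (1 - k / n) * bcoeff n"
      using assms by (simp add: of_nat_diff field_simps)
    finally show ?thesis .
  qed
qed

text \<open>After division by \<open>bcoeff n\<close> the weights lie between \<open>1 - k/n\<close>
  and 1. Both bounds are summed against the exponential series, where the sum of
  \<open>k * x^k / fact k\<close> is \<open>x * exp x\<close>.\<close>

lemma exp_convolution_bounds:
  fixes x :: real
  assumes "x \<ge> 0" "n > 0"
  defines "S \<equiv> \<Sum>k\<le>n. x ^ k / fact k * bcoeff (n - k)"
  shows "exp x * (1 - x / n) * bcoeff n \<le> S" "S \<le> exp x * bcoeff n"
proof -
  define a where "a k = x ^ k / fact k" for k
  define w where "w k = (if k \<le> n then bcoeff (n - k) / bcoeff n else 0)" for k
  have w: "0 \<le> w k" "w k \<le> 1" "1 - k / n \<le> w k" for k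
    using bcoeff_pos[of n] bcoeff_pos[of "n - k"] bcoeff_bounds[OF assms(2), of k] assms(2)
    by (simp_all add: w_def field_simps)
  have a: "a k \<ge> 0" for k using assms(1) by (simp add: a_def)
  have a_sums: "a sums exp x"
    using exp_converges[of x] by (simp add: a_def[abs_def] divide_inverse mult_ac)
  have "(\<lambda>k. real (Suc k) * a (Suc k)) = (\<lambda>k. x * a k)"
    by (rule ext) (simp add: a_def divide_simps del: of_nat_Suc)
  then have "(\<lambda>k. real (Suc k) * a (Suc k)) sums (x * exp x)"
    using sums_mult[OF a_sums, of x] by simp
  then have ka_sums: "(\<lambda>k. real k * a k) sums (x * exp x)"
    using sums_Suc[of "\<lambda>k. real k * a k"] by simp
  have S_sums: "(\<lambda>k. a k * w k) sums (S / bcoeff n)"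
  proof -
    have "(\<lambda>k. a k * w k) sums (\<Sum>k\<le>n. a k * w k)"
      by (rule sums_finite) (auto simp: w_def)
    also have "(\<Sum>k\<le>n. a k * w k) = S / bcoeff n"
      by (simp add: S_def sum_divide_distrib w_def a_def)
    finally show ?thesis .
  qed
  have "S / bcoeff n \<le> exp x"
    using w(2) a by (intro sums_le[OF _ S_sums a_sums]) (simp add: mult_left_le)
  then show "S \<le> exp x * bcoeff n" using bcoeff_pos[of n] by (simp add: pos_divide_le_eq)
  text \<open>\<open>w\<close> vanishes beyond \<open>n\<close>, where \<open>1 - k/n\<close> is negative, so the bound can be summed over all \<open>k\<close>.\<close>
  have lower_sums: "(\<lambda>k. a k - real k * a k / n) sums (exp x - x * exp x / n)"
    by (intro sums_diff a_sums sums_divide ka_sums)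
  have "a k - real k * a k / n \<le> a k * w k" for k
    using mult_left_mono[OF w(3)[of k] a[of k]] by (simp add: algebra_simps)
  then have "exp x - x * exp x / n \<le> S / bcoeff n"
    by (rule sums_le[OF _ lower_sums S_sums])
  then have "(exp x - x * exp x / n) * bcoeff n \<le> S" using bcoeff_pos[of n] by (simp add: pos_le_divide_eq)
  then show "exp x * (1 - x / n) * bcoeff n \<le> S" by (simp add: algebra_simps)
qed

section \<open>Gamma function estimates for \<open>bcoeff\<close>\<close>

lemma Gamma_log_convex:
  fixes x y t :: real
  assumes "x > 0" "y > 0" "0 \<le> t" "t \<le> 1"
  shows "Gamma ((1 - t) * x + t * y) \<le> Gamma x powr (1 - t) * Gamma y powr t"
proof -
  have "(1 - t) * x + t * y > 0"
    using convexD_alt[of "{0 :: real<..}" x y t] assms by simp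
  moreover have "ln (Gamma ((1 - t) * x + t * y)) \<le> (1 - t) * ln (Gamma x) + t * ln (Gamma y)"
    using convex_onD[OF log_convex_Gamma_real, of t x y] assms by (simp add: o_def)
  moreover have "(1 - t) * ln (Gamma x) + t * ln (Gamma y) = ln (Gamma x powr (1 - t) * Gamma y powr t)"
    using Gamma_real_pos[OF assms(1)] Gamma_real_pos[OF assms(2)] by (simp add: ln_mult ln_powr)
  ultimately show ?thesis
    using Gamma_real_pos[OF assms(1)] Gamma_real_pos[OF assms(2)] Gamma_real_pos
    by (subst ln_le_cancel_iff[symmetric]) auto
qed

text \<open>The upper half of Wendel's inequality: \<open>x + s\<close> lies between
  \<open>x\<close> and \<open>x + 1\<close>, and \<open>Gamma (x + 1) = x * Gamma x\<close>.\<close>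

lemma Gamma_add_le:
  fixes x s :: real
  assumes "x > 0" "0 \<le> s" "s \<le> 1"
  shows "Gamma (x + s) \<le> x powr s * Gamma x"
proof -
  have "Gamma (x + s) = Gamma ((1 - s) * x + s * (x + 1))" by (simp add: algebra_simps)
  also have "\<dots> \<le> Gamma x powr (1 - s) * Gamma (x + 1) powr s"
    using assms by (intro Gamma_log_convex) auto
  also have "Gamma (x + 1) = x * Gamma x"
    using assms by (intro Gamma_plus1) (auto elim!: nonpos_Ints_cases)
  also have "Gamma x powr (1 - s) * (x * Gamma x) powr s = x powr s * (Gamma x powr (1 - s) * Gamma x powr s)"
    using assms Gamma_real_pos[of x] by (simp add: powr_mult)
  also have "Gamma x powr (1 - s) * Gamma x powr s = Gamma x"
    using assms Gamma_real_pos[of x] by (simp flip: powr_add)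
  finally show ?thesis .
qed

lemma bcoeff_Gamma_bounds:
  shows "bcoeff n * Gamma (5 / 4) \<le> (real n + 1) powr (1 / 4)"
    and "(real n + 1 / 4) powr (1 / 4) \<le> bcoeff n * Gamma (5 / 4)"
proof -
  have "Gamma (real n + 1) = fact n" using Gamma_fact[of n, where 'a = real] by (simp add: add.commute)
  moreover have "pochhammer (5 / 4 :: real) n = Gamma (5 / 4 + real n) / Gamma (5 / 4)"
    by (rule pochhammer_Gamma) (auto elim!: nonpos_Ints_cases)
  ultimately have b: "bcoeff n * Gamma (5 / 4) = Gamma (real n + 5 / 4) / Gamma (real n + 1)"
    using Gamma_real_pos[of "5 / 4"] by (simp add: bcoeff_def add.commute less_imp_neq[symmetric])
  have pos: "Gamma (real n + 1) > 0" by (simp add: Gamma_real_pos)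
  have "Gamma (real n + 5 / 4) \<le> (real n + 1) powr (1 / 4) * Gamma (real n + 1)"
    using Gamma_add_le[of "real n + 1" "1 / 4"] by (simp add: add.assoc)
  then show "bcoeff n * Gamma (5 / 4) \<le> (real n + 1) powr (1 / 4)"
    using pos unfolding b by (simp add: pos_divide_le_eq)
  \<comment> \<open>For the lower bound, a step of 3/4 leads from \<open>?y\<close> to
    \<open>n + 1\<close>, and the functional equation from \<open>?y\<close> to
    \<open>n + 5/4\<close>.\<close>
  let ?y = "real n + 1 / 4"
  have "Gamma (real n + 1) \<le> ?y powr (3 / 4) * Gamma ?y"
    using Gamma_add_le[of ?y "3 / 4"] by (simp add: add.assoc)
  then have "?y powr (1 / 4) * Gamma (real n + 1) \<le> ?y powr (1 / 4) * (?y powr (3 / 4) * Gamma ?y)"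
    by (intro mult_left_mono) auto
  also have "\<dots> = ?y * Gamma ?y"
    by (simp flip: mult.assoc powr_add)
  also have "\<dots> = Gamma (?y + 1)"
    by (rule Gamma_plus1[symmetric]) (auto elim!: nonpos_Ints_cases)
  finally have "?y powr (1 / 4) * Gamma (real n + 1) \<le> Gamma (real n + 5 / 4)"
    by (simp add: add.assoc)
  then show "?y powr (1 / 4) \<le> bcoeff n * Gamma (5 / 4)"
    using pos unfolding b by (simp add: pos_le_divide_eq)
qed

text \<open>Pulling out \<open>2 ^ m\<close> uses
  \<open>(1/2)^k * 2^(m - k) = 2^m * (1/4)^k\<close>, which is the origin of the constant
  \<open>exp (1 / 4)\<close>.\<close>

lemma compacted_count_Suc_eq_convolution:
  "real (compacted_count 1 (Suc m)) =
     fact m * 2 ^ m * (\<Sum>k\<le>m. (1 / 4) ^ k / fact k * bcoeff (m - k))" (is "_ = _ * ?T")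
proof -
  define T where "T = ?T"
  have "real (compacted_count 1 (Suc m)) / fact m
      = fps_nth (fps_exp (1 / 2 :: real) * binomial_series) m"
    by (simp flip: compacted_count_series_eq)
  also have "\<dots> = (\<Sum>k\<le>m. (1 / 2) ^ k / fact k * (2 ^ (m - k) * bcoeff (m - k)))"
    by (simp add: fps_mult_nth binomial_series_def bcoeff_def atLeast0AtMost)
  also have "\<dots> = (\<Sum>k\<le>m. 2 ^ m * ((1 / 4) ^ k / fact k * bcoeff (m - k)))"
  proof (rule sum.cong)
    fix k assume "k \<in> {..m}"
    then have "(2 :: real) ^ m = 2 ^ k * 2 ^ (m - k)" by (simp flip: power_add)
    moreover have "(4 :: real) ^ k = 2 ^ k * 2 ^ k" by (simp flip: power_mult_distrib)
    ultimately show "(1 / 2) ^ k / fact k * (2 ^ (m - k) * bcoeff (m - k)) =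
        2 ^ m * ((1 / 4) ^ k / fact k * bcoeff (m - k))"
      by (simp add: power_divide)
  qed simp
  also have "\<dots> = 2 ^ m * T" unfolding T_def by (rule sum_distrib_left[symmetric])
  finally show ?thesis
    unfolding T_def[symmetric] by (simp add: divide_eq_eq mult_ac)
qed

section \<open>Comparison with the asymptotic term\<close>

definition compacted_asymp :: "nat \<Rightarrow> real" where
  "compacted_asymp n = exp (1 / 4) / Gamma (1 / 4) * (fact n * 2 ^ (n + 1) / real n powr (3 / 4))"

lemma compacted_asymp_pos: "n > 0 \<Longrightarrow> compacted_asymp n > 0"
  by (simp add: compacted_asymp_def Gamma_real_pos)

text \<open>Brings out the prefactor of the convolution formula; the 4 in
  \<open>Gamma (1/4) = 4 * Gamma (5/4)\<close> cancels against \<open>2 ^ (m + 2)\<close>.\<close>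

lemma compacted_asymp_Suc:
  "compacted_asymp (Suc m) =
     fact m * 2 ^ m * (exp (1 / 4) * real (Suc m) powr (1 / 4) / Gamma (5 / 4))"
proof -
  define x where "x = real (Suc m)"
  have "x > 0" by (simp add: x_def)
  have "Gamma (1 / 4 + 1 :: real) = 1 / 4 * Gamma (1 / 4)"
    by (rule Gamma_plus1) (auto elim!: nonpos_Ints_cases)
  then have G: "Gamma (1 / 4 :: real) = 4 * Gamma (5 / 4)" by simp
  have "x powr (1 / 4) * x powr (3 / 4) = x"
    using \<open>x > 0\<close> by (simp flip: powr_add)
  then have "x / x powr (3 / 4) = x powr (1 / 4)"
    using \<open>x > 0\<close> by (simp add: nonzero_divide_eq_eq)
  moreover have "compacted_asymp (Suc m) =
      fact m * 2 ^ m * (exp (1 / 4) * (x / x powr (3 / 4)) / Gamma (5 / 4))"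
    by (simp add: compacted_asymp_def G x_def mult_ac)
  ultimately show ?thesis by (simp add: x_def)
qed

lemma compacted_count_asymp_bounds:
  assumes "n \<ge> 2"
  shows "real (compacted_count 1 n) \<le> compacted_asymp n"
    and "(1 - 2 / n) * compacted_asymp n \<le> real (compacted_count 1 n)"
proof -
  obtain m where n: "n = Suc m" and m: "m \<ge> 1" using assms by (cases n) auto
  define S where "S = (\<Sum>k\<le>m. (1 / 4) ^ k / fact k * bcoeff (m - k))"
  define P :: real where "P = fact m * 2 ^ m"
  have P: "P > 0" by (simp add: P_def)
  have G: "Gamma (5 / 4 :: real) > 0" by (simp add: Gamma_real_pos)
  have c: "real (compacted_count 1 n) = P * S"
    unfolding n P_def S_def by (rule compacted_count_Suc_eq_convolution)
  have A: "compacted_asymp n = P * (exp (1 / 4) * real n powr (1 / 4) / Gamma (5 / 4))"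
    unfolding n P_def by (rule compacted_asymp_Suc)
  have S: "exp (1 / 4) * (1 - (1 / 4) / m) * bcoeff m \<le> S" "S \<le> exp (1 / 4) * bcoeff m"
    unfolding S_def using m by (intro exp_convolution_bounds; simp)+
  have b: "bcoeff m \<le> real n powr (1 / 4) / Gamma (5 / 4)"
    using bcoeff_Gamma_bounds(1)[of m] G by (simp add: n pos_le_divide_eq add.commute)
  have "S \<le> exp (1 / 4) * (real n powr (1 / 4) / Gamma (5 / 4))"
    using S(2) mult_left_mono[OF b, of "exp (1 / 4)"] by simp
  then show "real (compacted_count 1 n) \<le> compacted_asymp n"
    unfolding c A using P by (intro mult_left_mono) auto
  \<comment> \<open>\<open>u\<close> is the quotient of \<open>m + 1/4\<close>, from the lower Gamma
    bound, by \<open>n = m + 1\<close>.\<close>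
  define u where "u = 1 - (3 / 4) / n"
  have u: "0 < u" "u \<le> 1" using assms by (simp_all add: u_def field_simps)
  have "real m + 1 / 4 = real n * u" using assms by (simp add: u_def n field_simps)
  then have "(real n * u) powr (1 / 4) / Gamma (5 / 4) \<le> bcoeff m"
    using bcoeff_Gamma_bounds(2)[of m] G by (simp add: pos_divide_le_eq)
  \<comment> \<open>As \<open>u\<close> is at most 1, its fourth root can be replaced by the smaller
    \<open>u\<close>, which is linear in \<open>1/n\<close>.\<close>
  moreover have "u \<le> u powr (1 / 4)"
    using powr_mono'[of "1 / 4" 1 u] u by simp
  then have "real n powr (1 / 4) * u \<le> (real n * u) powr (1 / 4)"
    using u by (simp add: powr_mult mult_left_mono)
  then have "real n powr (1 / 4) * u / Gamma (5 / 4) \<le> (real n * u) powr (1 / 4) / Gamma (5 / 4)"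
    using G by (intro divide_right_mono) auto
  ultimately have b': "real n powr (1 / 4) * u / Gamma (5 / 4) \<le> bcoeff m" by linarith
  have v: "0 \<le> 1 - (1 / 4) / m" using m by (simp add: field_simps)
  \<comment> \<open>Since \<open>n \<le> 2 * m\<close>, the two losses are at most
    \<open>(1/2)/n\<close> and \<open>(3/4)/n\<close>; 2 is a generous total.\<close>
  have "1 - 2 / n \<le> (1 - (1 / 4) / m) * u"
  proof -
    have "(1 / 4) / m \<le> (1 / 2) / n" using m by (simp add: n field_simps)
    moreover have "(1 - (1 / 4) / m) * u = 1 - (1 / 4) / m - (3 / 4) / n + (1 / 4) / m * ((3 / 4) / n)"
    proof -
      have "(1 - p) * (1 - q) = 1 - p - q + p * q" for p q :: real
        by (simp add: algebra_simps)
      then show ?thesis unfolding u_def .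
    qed
    moreover have "0 \<le> (1 / 4) / m * ((3 / 4) / n)" by simp
    moreover have "2 / n = (1 / 2) / n + (3 / 4) / n + (3 / 4) / real n" by (simp add: field_simps)
    moreover have "0 \<le> (3 / 4) / real n" by simp
    ultimately show ?thesis by linarith
  qed
  then have "(1 - 2 / n) * (exp (1 / 4) * real n powr (1 / 4) / Gamma (5 / 4))
      \<le> (1 - (1 / 4) / m) * u * (exp (1 / 4) * real n powr (1 / 4) / Gamma (5 / 4))"
    using G by (intro mult_right_mono) auto
  also have "\<dots> = exp (1 / 4) * (1 - (1 / 4) / m) * (real n powr (1 / 4) * u / Gamma (5 / 4))"
    by simp
  also have "\<dots> \<le> exp (1 / 4) * (1 - (1 / 4) / m) * bcoeff m"
    by (intro mult_left_mono b' mult_nonneg_nonneg v) simp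
  also have "\<dots> \<le> S" by (rule S(1))
  finally have "P * ((1 - 2 / n) * (exp (1 / 4) * real n powr (1 / 4) / Gamma (5 / 4))) \<le> P * S"
    using P by (intro mult_left_mono) auto
  then show "(1 - 2 / n) * compacted_asymp n \<le> real (compacted_count 1 n)"
    unfolding c A by (simp only: mult_ac)
qed

lemma compacted_count_asymptotics:
  "\<exists>\<epsilon> :: nat \<Rightarrow> real. \<epsilon> \<in> O(\<lambda>n. 1 / real n) \<and>
     (\<forall>n>0. real (compacted_count 1 n) = compacted_asymp n * (1 + \<epsilon> n))"
proof (intro exI conjI)
  \<comment> \<open>The relative error, which lies between \<open>- 2/n\<close> and 0 from
    \<open>n = 2\<close> on.\<close>
  let ?\<epsilon> = "\<lambda>n. real (compacted_count 1 n) / compacted_asymp n - 1"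
  show "\<forall>n>0. real (compacted_count 1 n) = compacted_asymp n * (1 + ?\<epsilon> n)"
    using compacted_asymp_pos by (metis add.commute diff_add_cancel less_irrefl nonzero_mult_div_cancel_left times_divide_eq_right)
  have "norm (?\<epsilon> n) \<le> 2 * norm (1 / real n)" if "n \<ge> 2" for n
  proof -
    have "?\<epsilon> n \<le> 0" "- (2 / n) \<le> ?\<epsilon> n"
      using compacted_count_asymp_bounds[OF that] compacted_asymp_pos[of n] that
      by (simp_all add: pos_divide_le_eq pos_le_divide_eq[symmetric] flip: diff_le_eq)
    then show ?thesis by simp
  qed
  then show "?\<epsilon> \<in> O(\<lambda>n. 1 / real n)"
    by (intro bigoI[where c = 2] eventually_mono[OF eventually_ge_at_top[of 2]])
qed

theorem mainTheorem15:
  shows "D_finite (compacted_egf 1)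
    \<and> (1 - 2 * fps_X) * fps_deriv (fps_deriv (compacted_egf 1))
        - (3 - fps_X) * fps_deriv (compacted_egf 1) = 0
    \<and> fps_nth (compacted_egf 1) 0 = 1
    \<and> fps_nth (fps_deriv (compacted_egf 1)) 0 = 1
    \<and> (\<lambda>z. exp (z / 2) / (1 - 2 * z) powr (5 / 4)) has_fps_expansion fps_deriv (compacted_egf 1)
    \<and> (\<exists>\<epsilon> :: nat \<Rightarrow> real. \<epsilon> \<in> O(\<lambda>n. 1 / real n) \<and>
         (\<forall>n>0. real (compacted_count 1 n) =
            exp (1 / 4) / Gamma (1 / 4) * (fact n * 2 ^ (n + 1) / real n powr (3 / 4))
              * (1 + \<epsilon> n)))"
proof -
  have ODE: "(1 - 2 * fps_X) * fps_deriv (fps_deriv (compacted_egf 1))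
      - (3 - fps_X) * fps_deriv (compacted_egf 1) = 0"
    unfolding fps_deriv_compacted_egf compacted_count_series_ODE by simp
  have "(\<lambda>z. exp (1 / 2 * z) * (1 - 2 * z) powr (- (5 / 4))) has_fps_expansion
      fps_exp (1 / 2 :: complex) * binomial_series"
    by (intro has_fps_expansion_mult has_fps_expansion_exp has_fps_expansion_binomial_series)
  then have "(\<lambda>z. exp (z / 2) / (1 - 2 * z) powr (5 / 4)) has_fps_expansion
      fps_deriv (compacted_egf 1)"
    unfolding fps_deriv_compacted_egf compacted_count_series_eq by (simp add: powr_minus_divide)
  moreover have "fps_nth (compacted_egf 1) 0 = 1"
    using compacted_count_0 by (simp add: compacted_egf_def)
  moreover have "fps_nth (fps_deriv (compacted_egf 1)) 0 = 1"
    unfolding fps_deriv_compacted_egf using compacted_count_1 by simp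
  ultimately show ?thesis
    using ODE D_finite_if_ODE[OF ODE] compacted_count_asymptotics
    unfolding compacted_asymp_def by blast
qed

end
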